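(* For every integer $n\ge 3$, the bubble-sort graph $Sym_n(t)$ satisfies $$N(Sym_n(t),1)=2\quad\text{and}\quad N(Sym_n(t),2)=2(n-1).$$
   Context: For an integer $n$, $Sym_n$ is the symmetric group on $\{1,\dots,n\}$. The bubble-sort graph $Sym_n(t)$ is the Cayley graph with vertex set $Sym_n$ and edges $\{g,gs\}$ for $g\in Sym_n$, $s\in t$, where $t=\{t_{i,i+1}: 1\le i<n\}$ is the set of adjacent transpositions ($t_{i,i+1}$ is the transposition interchanging $i$ and $i+1$). For a finite connected simple graph $\Gamma$ with vertex set $V(\Gamma)$ and path distance $d$, let $B_r(x)=\{y\in V(\Gamma): d(x,y)\le r\}$ and $$N(\Gamma,r)=\max_{x,y\in V(\Gamma),\ x\ne y}|B_r(x)\cap B_r(y)|.$$ *)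

theory Defs
  imports
    "HOL-Algebra.Sym_Groups"
    "Graph_Theory.Pair_Digraph"
    "Graph_Theory.Shortest_Path"
    "Graph_Theory.Digraph_Component"
begin

text \<open>
  As in the graph library, an undirected graph is a symmetric digraph: the edge \<open>{g, g s}\<close>
  is represented by the two arcs \<open>(g, g s)\<close> and \<open>(g s, g)\<close>.
\<close>

definition cayley_graph :: "('a, 'b) monoid_scheme \<Rightarrow> 'a set \<Rightarrow> 'a pair_pre_digraph" where
  "cayley_graph G S =
     \<lparr> pverts = carrier G,
       parcs = (\<Union>g \<in> carrier G. \<Union>s \<in> S. {(g, g \<otimes>\<^bsub>G\<^esub> s), (g \<otimes>\<^bsub>G\<^esub> s, g)}) \<rparr>"

definition adjacent_transpositions :: "nat \<Rightarrow> (nat \<Rightarrow> nat) set" where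
  "adjacent_transpositions n = {transpose i (i + 1) | i. 1 \<le> i \<and> i < n}"

definition bubble_sort_graph :: "nat \<Rightarrow> (nat \<Rightarrow> nat) pair_pre_digraph" where
  "bubble_sort_graph n = cayley_graph (sym_group n) (adjacent_transpositions n)"

text \<open>
  Path distance is the library's minimal walk cost for unit arc weights; it is
  an extended real, infinite when there is no walk.
\<close>

definition graph_dist :: "('a, 'b) pre_digraph \<Rightarrow> 'a \<Rightarrow> 'a \<Rightarrow> ereal" where
  "graph_dist G x y = wf_digraph.\<mu> G (\<lambda>_. 1) x y"

definition graph_ball :: "('a, 'b) pre_digraph \<Rightarrow> nat \<Rightarrow> 'a \<Rightarrow> 'a set" where
  "graph_ball G r x = {y \<in> verts G. graph_dist G x y \<le> ereal (real r)}"

text \<open>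
  Unspecified when \<open>G\<close> has fewer than two vertices, since then the maximum ranges over the empty set.
\<close>

definition max_ball_inter :: "('a, 'b) pre_digraph \<Rightarrow> nat \<Rightarrow> nat" where
  "max_ball_inter G r =
     Max {card (graph_ball G r x \<inter> graph_ball G r y) | x y. x \<in> verts G \<and> y \<in> verts G \<and> x \<noteq> y}"

text \<open>The bubble-sort graph is a finite connected simple graph.\<close>

lemma adjacent_transposition_permutes:
  assumes "s \<in> adjacent_transpositions n"
  shows "s permutes {1..n}"
  using assms by (auto simp: adjacent_transpositions_def intro!: permutes_swap_id)

lemma pverts_bubble_sort_graph: "pverts (bubble_sort_graph n) = {p. p permutes {1..n}}"
  by (simp add: bubble_sort_graph_def cayley_graph_def sym_group_def)

lemma parcs_bubble_sort_graph:
  "parcs (bubble_sort_graph n) =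
     {(g, g \<circ> s) | g s. g permutes {1..n} \<and> s \<in> adjacent_transpositions n}"
proof -
  have inv: "(g \<circ> s) \<circ> s = g" if "s \<in> adjacent_transpositions n" for g s :: "nat \<Rightarrow> nat"
    using that by (auto simp: adjacent_transpositions_def comp_assoc)
  have perm: "g \<circ> s permutes {1..n}"
    if "g permutes {1..n}" "s \<in> adjacent_transpositions n" for g s
    by (rule permutes_compose[OF adjacent_transposition_permutes[OF that(2)] that(1)])
  have rev_arc: "(g \<circ> s, g) \<in> {(g, g \<circ> s) | g s. g permutes {1..n} \<and> s \<in> adjacent_transpositions n}"
    if "g permutes {1..n}" "s \<in> adjacent_transpositions n" for g s
    unfolding mem_Collect_eq
    by (intro exI[of _ "g \<circ> s"] exI[of _ s] conjI perm[OF that] that(2))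
      (simp only: inv[OF that(2)])
  have "parcs (bubble_sort_graph n) =
      (\<Union>g \<in> {p. p permutes {1..n}}. \<Union>s \<in> adjacent_transpositions n. {(g, g \<circ> s), (g \<circ> s, g)})"
    by (simp add: bubble_sort_graph_def cayley_graph_def sym_group_def)
  then show ?thesis
    using rev_arc by blast
qed

lemma pair_graph_bubble_sort_graph: "pair_graph (bubble_sort_graph n)"
proof -
  let ?G = "bubble_sort_graph n"
  have verts: "u permutes {1..n}" "v permutes {1..n}" if "(u, v) \<in> parcs ?G" for u v
    using that permutes_compose[OF adjacent_transposition_permutes]
    unfolding parcs_bubble_sort_graph by blast+
  have fin: "finite (pverts ?G)"
    by (simp add: pverts_bubble_sort_graph finite_permutations)
  have "parcs ?G \<subseteq> pverts ?G \<times> pverts ?G"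
    using verts by (auto simp: pverts_bubble_sort_graph)
  then have fin_arcs: "finite (parcs ?G)"
    using fin by (meson finite_SigmaI finite_subset)
  have loopfree: "u \<noteq> v" if "(u, v) \<in> parcs ?G" for u v
  proof
    assume "u = v"
    with that obtain i where "u permutes {1..n}" and "u = u \<circ> transpose i (i + 1)"
      by (auto simp: parcs_bubble_sort_graph adjacent_transpositions_def)
    then have "u i = u (i + 1)" and "inj u"
      using comp_apply[of u "transpose i (i + 1)" i] permutes_inj by auto
    then show False
      using injD[of u i "i + 1"] by simp
  qed
  have "sym (parcs ?G)"
    unfolding bubble_sort_graph_def cayley_graph_def sym_def by auto
  then have "symmetric (with_proj ?G)"
    by (simp add: symmetric_def)
  then show ?thesis
    using verts fin fin_arcs loopfree
    by unfold_locales (auto simp: pverts_bubble_sort_graph)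
qed

lemma strongly_connected_bubble_sort_graph: "strongly_connected (bubble_sort_graph n)"
proof -
  let ?G = "bubble_sort_graph n"
  interpret pair_graph ?G
    by (rule pair_graph_bubble_sort_graph)
  have transp: "transpose a b permutes {1..n}" if "1 \<le> a" "a \<le> b" "b \<le> n" for a b :: nat
    using that by (auto intro!: permutes_swap_id)
  have arc: "(g, g \<circ> transpose i (i + 1)) \<in> parcs ?G"
    if "g permutes {1..n}" "1 \<le> i" "i < n" for g i
    unfolding parcs_bubble_sort_graph adjacent_transpositions_def using that by blast
  have step: "(g, g \<circ> transpose a (a + Suc d)) \<in> (parcs ?G)\<^sup>*"
    if "1 \<le> a" "a + Suc d \<le> n" "g permutes {1..n}" for g a d
    using that
  proof (induction d arbitrary: g)
    case 0
    then have "(g, g \<circ> transpose a (a + 1)) \<in> parcs ?G"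
      by (intro arc) auto
    then show ?case
      unfolding Suc_eq_plus1 add_0 by (rule r_into_rtrancl)
  next
    case (Suc d)
    define b where "b = a + Suc d"
    define h where "h = g \<circ> transpose a b"
    define k where "k = h \<circ> transpose b (b + 1)"
    have h: "h permutes {1..n}"
      unfolding h_def b_def using Suc.prems by (intro permutes_compose transp) auto
    have k: "k permutes {1..n}"
      unfolding k_def b_def using Suc.prems h by (intro permutes_compose transp) auto
    have "(g, h) \<in> (parcs ?G)\<^sup>*"
      unfolding h_def b_def by (rule Suc.IH) (use Suc.prems in auto)
    moreover have "(h, k) \<in> parcs ?G"
      unfolding k_def b_def using Suc.prems h by (intro arc) auto
    moreover have "(k, k \<circ> transpose a b) \<in> (parcs ?G)\<^sup>*"
      unfolding b_def by (rule Suc.IH) (use Suc.prems k in auto)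
    moreover have "k \<circ> transpose a b = g \<circ> transpose a (a + Suc (Suc d))"
      by (rule ext) (auto simp: k_def h_def b_def transpose_def)
    ultimately show ?case
      by (metis rtrancl.rtrancl_into_rtrancl rtrancl_trans)
  qed
  have step': "(g, g \<circ> transpose a b) \<in> (parcs ?G)\<^sup>*"
    if "a \<in> {1..n}" "b \<in> {1..n}" "g permutes {1..n}" for g a b
  proof (cases a b rule: linorder_cases)
    case less
    then have b: "a + Suc (b - Suc a) = b" by simp
    show ?thesis
      using step[of a "b - Suc a" g, unfolded b] that by auto
  next
    case equal
    then show ?thesis by simp
  next
    case greater
    then have a: "b + Suc (a - Suc b) = a" by simp
    show ?thesis
      using step[of b "a - Suc b" g, unfolded a] that by (auto simp: transpose_commute)
  qed
  have walk: "\<forall>g. g permutes {1..n} \<longrightarrow> (g, g \<circ> p) \<in> (parcs ?G)\<^sup>*"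
    if "p permutes {1..n}" for p
    using that finite_atLeastAtMost[of 1 n]
  proof (induction p rule: permutes_induct)
    case id
    then show ?case by simp
  next
    case (swap a b p)
    show ?case
    proof (intro allI impI)
      fix g assume g: "g permutes {1..n}"
      have "transpose a b permutes {1..n}"
        using swap by (simp add: permutes_swap_id)
      then have "g \<circ> transpose a b permutes {1..n}"
        using g permutes_compose by blast
      then have "(g \<circ> transpose a b, (g \<circ> transpose a b) \<circ> p) \<in> (parcs ?G)\<^sup>*"
        using swap by blast
      moreover have "(g, g \<circ> transpose a b) \<in> (parcs ?G)\<^sup>*"
        using step' swap g by blast
      ultimately show "(g, g \<circ> (transpose a b \<circ> p)) \<in> (parcs ?G)\<^sup>*"
        by (simp add: comp_assoc)
    qed
  qed
  have "(u, v) \<in> (parcs ?G)\<^sup>*" if u: "u permutes {1..n}" and v: "v permutes {1..n}" for u v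
  proof -
    have "u \<circ> (inv' u \<circ> v) = v"
      using permutes_inv_o(1)[OF u] by (simp flip: comp_assoc)
    moreover have "inv' u \<circ> v permutes {1..n}"
      by (rule permutes_compose[OF v permutes_inv[OF u]])
    then have "(u, u \<circ> (inv' u \<circ> v)) \<in> (parcs ?G)\<^sup>*"
      using walk u by blast
    ultimately show ?thesis
      by (simp only:)
  qed
  then show ?thesis
    by (auto intro: permutes_id simp: strongly_connected_def reachable_conv pverts_bubble_sort_graph)
qed

end

theory Submission
  imports Defs
begin

text \<open>
  Multiplying a permutation \<open>p\<close> on the right by an adjacent transposition adds or removes exactly one
  pair in the inversion set \<open>I(p)\<close>, which determines \<open>p\<close>. By left invariance it suffices to bound
  \<open>|B\<^sub>r(1) \<inter> B\<^sub>r(y)|\<close> for \<open>y \<noteq> 1\<close>, and each \<open>z\<close> in this intersection satisfies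
  \<open>|I(z)| \<le> r\<close> and \<open>|I(z) \<triangle> I(y)| \<le> r\<close>. For \<open>r = 1\<close> this leaves at most two sets \<open>I(z)\<close>.

  Let \<open>r = 2\<close>. If \<open>|I(y)|\<close> is odd, then by parity \<open>z\<close> is adjacent to \<open>1\<close> or to \<open>y\<close>, giving at most
  \<open>2(n - 1)\<close> elements, and exactly that many if \<open>y\<close> is an adjacent transposition. If \<open>|I(y)| = 4\<close>,
  which forces \<open>n \<ge> 4\<close>, then \<open>I(z)\<close> is one of the six two-element subsets of \<open>I(y)\<close>. If \<open>|I(y)| = 2\<close>,
  then \<open>y\<close> is a product of two distinct adjacent transpositions and \<open>I(z)\<close> is empty or meets \<open>I(y)\<close>;
  counting such sets among the inversion sets of short words gives \<open>4 + 2(n - 3)\<close> if the two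
  transpositions commute and at most \<open>4 + (n - 3)\<close> otherwise.
\<close>

subsection \<open>Inversion sets\<close>

text \<open>Inversions are pairs of values, with \<open>inv' p\<close> giving their positions. Right
  multiplication by an adjacent transposition exchanges two neighbouring positions, so it reverses
  the order of a single pair of values.\<close>

definition inversions :: "(nat \<Rightarrow> nat) \<Rightarrow> (nat \<times> nat) set" where
  "inversions p = {(a, b). a < b \<and> inv' p b < inv' p a}"

lemma inversions_id [simp]: "inversions id = {}"
  by (auto simp: inversions_def)

text \<open>Only the two values at positions \<open>i\<close> and \<open>i + 1\<close> change their
  relative order. \<open>min\<close> and \<open>max\<close> write this pair in increasing order,
  whether it is being created or removed.\<close>

lemma inversions_comp_transpose:
  assumes "bij p"
  shows "inversions (p \<circ> transpose i (i + 1)) =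
    sym_diff (inversions p) {(min (p i) (p (i + 1)), max (p i) (p (i + 1)))}"
proof -
  have "(a, b) \<in> inversions (p \<circ> transpose i (i + 1)) \<longleftrightarrow>
      (a, b) \<in> sym_diff (inversions p) {(min (p i) (p (i + 1)), max (p i) (p (i + 1)))}" for a b
  proof -
    define u v where "u = inv' p a" and "v = inv' p b"
    have ab: "a = p u" "b = p v"
      using assms by (simp_all add: u_def v_def bij_is_surj surj_f_inv_f)
    have inj: "p x = p y \<longleftrightarrow> x = y" for x y
      using assms bij_is_inj inj_eq by metis
    have inv: "inv' (p \<circ> transpose i (i + 1)) = transpose i (i + 1) \<circ> inv' p"
      using assms by (simp add: o_inv_distrib)
    have mem: "(a, b) \<in> {(min (p i) (p (i + 1)), max (p i) (p (i + 1)))} \<longleftrightarrow>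
        a < b \<and> (u = i \<and> v = i + 1 \<or> u = i + 1 \<and> v = i)"
      using less_linear[of "p i" "p (i + 1)"] by (auto simp: ab inj min_def max_def)
    \<comment> \<open>No position lies strictly between \<open>i\<close> and \<open>i + 1\<close>,
      so exchanging them preserves the order of every other pair of positions.\<close>
    have swap: "transpose i (i + 1) v < transpose i (i + 1) u \<longleftrightarrow>
        (if u = i \<and> v = i + 1 \<or> u = i + 1 \<and> v = i then \<not> v < u else v < u)" if "u \<noteq> v"
      using that by (auto simp: transpose_def)
    show ?thesis
    proof (cases "a < b")
      case True
      then have "u \<noteq> v"
        by (auto simp: ab)
      then show ?thesis
        using swap True unfolding Un_iff Diff_iff mem inversions_def inv
        by (auto simp: u_def[symmetric] v_def[symmetric])
    next
      case False
      then show ?thesis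
        unfolding Un_iff Diff_iff mem by (simp add: inversions_def)
    qed
  qed
  then show ?thesis
    unfolding set_eq_iff split_paired_All by blast
qed

text \<open>The inverse fixes every number outside \<open>{1..n}\<close> and maps
  \<open>{1..n}\<close> to itself, so a value outside the interval keeps its order relative to all
  others.\<close>

lemma inversions_subset:
  assumes "p permutes {1..n}"
  shows "inversions p \<subseteq> {(a, b). 1 \<le> a \<and> a < b \<and> b \<le> n}"
proof clarify
  fix a b assume "(a, b) \<in> inversions p"
  then have lt: "a < b" "inv' p b < inv' p a"
    by (auto simp: inversions_def)
  have q: "inv' p permutes {1..n}"
    using assms by (rule permutes_inv)
  have fix_out: "inv' p c = c" if "c \<notin> {1..n}" for c
    using q that by (rule permutes_not_in)
  have bound: "inv' p c \<in> {1..n} \<longleftrightarrow> c \<in> {1..n}" for c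
    using q by (rule permutes_in_image)
  have "1 \<le> a"
    using fix_out[of a] lt by (cases "a = 0") auto
  moreover have "b \<le> n"
    using fix_out[of a] fix_out[of b] bound[of a] lt by (cases "b \<le> n"; cases "a \<le> n") auto
  ultimately show "1 \<le> a \<and> a < b \<and> b \<le> n"
    using lt by simp
qed

lemma finite_inversions:
  assumes "p permutes {1..n}"
  shows "finite (inversions p)"
proof (rule finite_subset[OF inversions_subset[OF assms]])
  show "finite {(a, b). 1 \<le> a \<and> a < b \<and> b \<le> n}"
    by (rule finite_subset[of _ "{1..n} \<times> {1..n}"]) auto
qed

text \<open>The inversion set tells which of any two values is placed first. This fixes the number
  of values in front of a given one, hence its position.\<close>

lemma inversions_inj:
  assumes p: "p permutes {1..n}" and q: "q permutes {1..n}"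
    and eq: "inversions p = inversions q"
  shows "p = q"
proof -
  have less_iff: "inv' p a < inv' p b \<longleftrightarrow> inv' q a < inv' q b" for a b
  proof -
    have inj: "inv' p a = inv' p b \<longleftrightarrow> a = b" "inv' q a = inv' q b \<longleftrightarrow> a = b"
      using permutes_inv[OF p] permutes_inv[OF q] permutes_inj inj_eq by metis+
    have "(a, b) \<in> inversions p \<longleftrightarrow> (a, b) \<in> inversions q"
      "(b, a) \<in> inversions p \<longleftrightarrow> (b, a) \<in> inversions q"
      by (simp_all add: eq)
    then show ?thesis
      using inj by (cases a b rule: linorder_cases) (auto simp: inversions_def)
  qed
  (* the position of b is the number of values placed before it *)
  have pos: "inv' r b = card {c \<in> {1..n}. inv' r c < inv' r b} + 1"
    if "r permutes {1..n}" "b \<in> {1..n}" for r b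
  proof -
    have r: "inv' r permutes {1..n}"
      using that by (simp add: permutes_inv)
    have b: "inv' r b \<in> {1..n}"
      using permutes_in_image[OF r] that by simp
    have "inv' r ` {c \<in> {1..n}. inv' r c < inv' r b} = {1..<inv' r b}"
    proof
      show "inv' r ` {c \<in> {1..n}. inv' r c < inv' r b} \<subseteq> {1..<inv' r b}"
        using permutes_in_image[OF r] by fastforce
      show "{1..<inv' r b} \<subseteq> inv' r ` {c \<in> {1..n}. inv' r c < inv' r b}"
      proof
        fix k assume k: "k \<in> {1..<inv' r b}"
        then have "k \<in> inv' r ` {1..n}"
          using permutes_image[OF r] b by auto
        then show "k \<in> inv' r ` {c \<in> {1..n}. inv' r c < inv' r b}"
          using k by auto
      qed
    qed
    then have "card {c \<in> {1..n}. inv' r c < inv' r b} = card {1..<inv' r b}"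
      using card_image[OF permutes_inj_on[OF r]] by metis
    then show ?thesis
      using b by simp
  qed
  have "inv' p = inv' q"
  proof
    fix b
    show "inv' p b = inv' q b"
    proof (cases "b \<in> {1..n}")
      case True
      then show ?thesis
        using pos[OF p True] pos[OF q True] less_iff by simp
    next
      case False
      then show ?thesis
        using permutes_not_in[OF permutes_inv[OF p]] permutes_not_in[OF permutes_inv[OF q]] by simp
    qed
  qed
  then show ?thesis
    using inv_inv_eq permutes_bij[OF p] permutes_bij[OF q] by metis
qed

lemma inversions_nonempty:
  assumes "p permutes {1..n}" "p \<noteq> id"
  shows "inversions p \<noteq> {}"
  using inversions_inj[OF assms(1) permutes_id] assms(2) by auto

lemma inversions_comp_adjacent:
  assumes p: "p permutes {1..n}" and s: "s \<in> adjacent_transpositions n"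
  obtains x where "inversions (p \<circ> s) = sym_diff (inversions p) {x}"
  using assms inversions_comp_transpose[OF permutes_bij[OF p]]
  by (auto simp: adjacent_transpositions_def)

text \<open>Without a descent \<open>p\<close> would be nondecreasing on \<open>{1..n}\<close> and
  have no inversions, which forces \<open>p = id\<close>.\<close>

lemma exists_descent:
  fixes n :: nat
  assumes p: "p permutes {1..n}" and "p \<noteq> id"
  obtains i where "1 \<le> i" "i < n" "p (i + 1) < p i"
proof -
  have "\<exists>i. 1 \<le> i \<and> i < n \<and> p (i + 1) < p i"
  proof (rule ccontr)
    assume "\<not> ?thesis"
    then have le: "p i \<le> p (Suc i)" if "1 \<le> i" "i < n" for i :: nat
      using that by (auto simp: not_less)
    have mono: "p i \<le> p (i + d)" if "1 \<le> i" "i + d \<le> n" for i d :: nat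
      using that
    proof (induction d)
      case (Suc d)
      then show ?case using le[of "i + d"] by simp
    qed simp
    have "inversions p = {}"
    proof (rule ccontr)
      assume "inversions p \<noteq> {}"
      then obtain a b where ab: "(a, b) \<in> inversions p"
        by auto
      then have lt: "a < b" "inv' p b < inv' p a"
        by (auto simp: inversions_def)
      have "a \<in> {1..n}" "b \<in> {1..n}"
        using inversions_subset[OF p] ab by auto
      then have "inv' p a \<in> {1..n}" "inv' p b \<in> {1..n}"
        using permutes_in_image[OF permutes_inv[OF p]] by auto
      then have "p (inv' p b) \<le> p (inv' p a)"
        using mono[of "inv' p b" "inv' p a - inv' p b"] lt by simp
      then show False
        using lt by (simp add: permutes_inverses(1)[OF p])
    qed
    then show False
      using inversions_nonempty[OF assms] by simp
  qed
  then show thesis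
    using that by blast
qed

text \<open>At a descent \<open>i\<close> the pair \<open>(p (i + 1), p i)\<close> is an inversion,
  and exchanging the two entries removes exactly this pair. Iteration writes a permutation as a
  product of as many adjacent transpositions as it has inversions.\<close>

lemma remove_inversion:
  assumes p: "p permutes {1..n}" and card: "card (inversions p) = Suc k"
  obtains s q where "s \<in> adjacent_transpositions n" "q permutes {1..n}"
    "p = q \<circ> s" "card (inversions q) = k"
proof -
  have "p \<noteq> id"
    using card by auto
  with p obtain i where i: "1 \<le> i" "i < n" "p (i + 1) < p i"
    by (rule exists_descent)
  let ?s = "transpose i (i + 1)"
  have s: "?s \<in> adjacent_transpositions n"
    using i by (auto simp: adjacent_transpositions_def)
  have "inv' p (p j) = j" for j
    by (simp add: permutes_inverses(2)[OF p])
  then have mem: "(p (i + 1), p i) \<in> inversions p"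
    using i by (simp add: inversions_def)
  have "inversions (p \<circ> ?s) = inversions p - {(p (i + 1), p i)}"
    using inversions_comp_transpose[OF permutes_bij[OF p], of i] i mem by (auto simp: min_def max_def)
  then have "card (inversions (p \<circ> ?s)) = k"
    using mem card finite_inversions[OF p] by simp
  moreover have "p \<circ> ?s permutes {1..n}"
    by (rule permutes_compose[OF adjacent_transposition_permutes[OF s] p])
  moreover have "p = (p \<circ> ?s) \<circ> ?s"
    by (simp add: comp_assoc)
  ultimately show thesis
    using that s by blast
qed

subsection \<open>Balls\<close>

lemma (in wf_digraph) unit_dist_le_iff:
  "\<mu> (\<lambda>_. 1) x y \<le> ereal (real r) \<longleftrightarrow> (\<exists>p. awalk x p y \<and> length p \<le> r)"
proof
  have cost: "awalk_cost (\<lambda>_. 1) p = real (length p)" for p :: "'b list"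
    by (induction p) simp_all
  show "\<exists>p. awalk x p y \<and> length p \<le> r" if le: "\<mu> (\<lambda>_. 1) x y \<le> ereal (real r)"
  proof -
    \<comment> \<open>The distance is an infimum, so a strict bound is needed to extract a walk;
      lengths being integers, length below \<open>r + 1\<close> means at most
      \<open>r\<close>.\<close>
    have "\<mu> (\<lambda>_. 1) x y < ereal (real r + 1)"
      using le by (rule order.strict_trans1) simp
    then obtain p where "awalk x p y" "ereal (real (length p)) < ereal (real r + 1)"
      unfolding \<mu>_def INF_less_iff cost by auto
    then show ?thesis
      by (intro exI[of _ p]) auto
  qed
  show "\<mu> (\<lambda>_. 1) x y \<le> ereal (real r)" if "\<exists>p. awalk x p y \<and> length p \<le> r"
  proof -
    from that obtain p where p: "awalk x p y" "length p \<le> r"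
      by blast
    have "\<mu> (\<lambda>_. 1) x y \<le> ereal (real (length p))"
      using min_cost_le_walk_cost[OF p(1), of "\<lambda>_. 1"] by (simp add: cost)
    also have "\<dots> \<le> ereal (real r)"
      using p by simp
    finally show ?thesis .
  qed
qed

text \<open>The ball of radius \<open>r\<close> about the identity. New letters go on the left, to
  match the first arc of a walk, and inserting \<open>id\<close> allows words shorter than
  \<open>r\<close>.\<close>

primrec short_words :: "nat \<Rightarrow> nat \<Rightarrow> (nat \<Rightarrow> nat) set" where
  "short_words n 0 = {id}"
| "short_words n (Suc r) =
    insert id {s \<circ> w | s w. s \<in> adjacent_transpositions n \<and> w \<in> short_words n r}"

text \<open>Induction on the radius with the start vertex left general: the first arc of a nonempty
  walk leads from \<open>x\<close> to some \<open>x \<circ> s\<close>.\<close>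

lemma graph_ball_bubble_sort_graph:
  assumes x: "x permutes {1..n}"
  shows "graph_ball (bubble_sort_graph n) r x = (\<lambda>w. x \<circ> w) ` short_words n r"
proof -
  interpret pair_graph "bubble_sort_graph n"
    by (rule pair_graph_bubble_sort_graph)
  have walk: "(\<exists>p. awalk x p y \<and> length p \<le> r) \<longleftrightarrow> y \<in> (\<lambda>w. x \<circ> w) ` short_words n r"
    if "x permutes {1..n}" for x y
    using that
  proof (induction r arbitrary: x)
    case 0
    then show ?case
      by (auto simp: awalk_Nil_iff pverts_bubble_sort_graph)
  next
    case (Suc r)
    have "(\<exists>p. awalk x p y \<and> length p \<le> Suc r) \<longleftrightarrow>
        awalk x [] y \<or> (\<exists>e p. awalk x (e # p) y \<and> length p \<le> r)"
      by (metis Suc_le_mono length_Cons list.exhaust list.size(3) zero_le)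
    also have "\<dots> \<longleftrightarrow> x = y \<or> (\<exists>s \<in> adjacent_transpositions n. \<exists>p. awalk (x \<circ> s) p y \<and> length p \<le> r)"
      using Suc.prems
      by (auto simp: awalk_simps pverts_bubble_sort_graph parcs_bubble_sort_graph)
    also have "\<dots> \<longleftrightarrow> x = y \<or>
        (\<exists>s \<in> adjacent_transpositions n. y \<in> (\<lambda>w. (x \<circ> s) \<circ> w) ` short_words n r)"
      by (intro disj_cong refl bex_cong Suc.IH
          permutes_compose[OF adjacent_transposition_permutes Suc.prems])
    also have "\<dots> \<longleftrightarrow> y \<in> (\<lambda>w. x \<circ> w) ` short_words n (Suc r)"
      by (auto simp: comp_assoc image_iff)
    finally show ?case .
  qed
  show ?thesis
  proof (rule Set.set_eqI)
    fix y
    have "y \<in> graph_ball (bubble_sort_graph n) r x \<longleftrightarrow> (\<exists>p. awalk x p y \<and> length p \<le> r)"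
      unfolding graph_ball_def graph_dist_def unit_dist_le_iff using awalk_last_in_verts by auto
    also have "\<dots> \<longleftrightarrow> y \<in> (\<lambda>w. x \<circ> w) ` short_words n r"
      using x by (rule walk)
    finally show "y \<in> graph_ball (bubble_sort_graph n) r x \<longleftrightarrow> y \<in> (\<lambda>w. x \<circ> w) ` short_words n r" .
  qed
qed

section \<open>Short words and the inversions they change\<close>

lemma short_words_permutes: "w \<in> short_words n r \<Longrightarrow> w permutes {1..n}"
proof (induction r arbitrary: w)
  case 0
  then have "w = id" by simp
  then show ?case using permutes_id by metis
next
  case (Suc r)
  show ?case
  proof (cases "w = id")
    case True
    then show ?thesis using permutes_id by metis
  next
    case False
    then obtain s v where "w = s \<circ> v" "s \<in> adjacent_transpositions n" "v \<in> short_words n r"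
      using Suc.prems by auto
    then show ?thesis
      using permutes_compose[OF Suc.IH adjacent_transposition_permutes] by blast
  qed
qed

lemma finite_short_words: "finite (short_words n r)"
  by (rule finite_subset[OF _ finite_permutations[OF finite_atLeastAtMost[of 1 n]]])
    (blast intro: short_words_permutes)

lemma short_words_one: "short_words n 1 = insert id (adjacent_transpositions n)"
  by auto

lemma adjacent_transposition_involutory:
  "s \<in> adjacent_transpositions n \<Longrightarrow> s \<circ> s = id"
  by (auto simp: adjacent_transpositions_def)

lemma short_words_two:
  "short_words n 2 = insert id (adjacent_transpositions n \<union>
    {s \<circ> t | s t. s \<in> adjacent_transpositions n \<and> t \<in> adjacent_transpositions n})"
  unfolding numeral_2_eq_2 by (auto 4 3 intro: exI[of _ id])

text \<open>Each letter changes one pair, and symmetric differences obey the triangle inequality.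
  For \<open>p = id\<close> this bounds the number of inversions of \<open>w\<close> itself.\<close>

lemma card_sym_diff_le:
  assumes p: "p permutes {1..n}" and w: "w \<in> short_words n r"
  shows "card (sym_diff (inversions (p \<circ> w)) (inversions p)) \<le> r"
  using assms
proof (induction r arbitrary: p w)
  case 0
  then show ?case by simp
next
  case (Suc r)
  show ?case
  proof (cases "w = id")
    case False
    then obtain s v where w: "w = s \<circ> v" "s \<in> adjacent_transpositions n" "v \<in> short_words n r"
      using Suc.prems by auto
    have ps: "p \<circ> s permutes {1..n}"
      using permutes_compose[OF adjacent_transposition_permutes Suc.prems(1)] w by simp
    let ?A = "inversions p" and ?B = "inversions (p \<circ> s)" and ?C = "inversions (p \<circ> w)"
    obtain x where x: "?B = sym_diff ?A {x}"
      using inversions_comp_adjacent[OF Suc.prems(1) w(2)] .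
    have IH: "card (sym_diff ?C ?B) \<le> r"
      using Suc.IH[OF ps w(3)] unfolding w(1) comp_assoc .
    have "finite ?B" "finite ?C"
      by (rule finite_inversions[OF ps],
          rule finite_inversions[OF permutes_compose[OF short_words_permutes[OF Suc.prems(2)] Suc.prems(1)]])
    moreover have "sym_diff ?C ?A \<subseteq> insert x (sym_diff ?C ?B)"
      by (auto simp: x)
    ultimately have "card (sym_diff ?C ?A) \<le> card (insert x (sym_diff ?C ?B))"
      by (intro card_mono) auto
    also have "\<dots> \<le> Suc r"
      using IH card_insert_le_m1[of "Suc r" "sym_diff ?C ?B" x] by simp
    finally show ?thesis .
  qed simp
qed

text \<open>One pair is added or removed, so the parity of the inversion number is a 2-colouring of
  the graph.\<close>

lemma even_card_inversions_comp:
  assumes p: "p permutes {1..n}" and s: "s \<in> adjacent_transpositions n"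
  shows "even (card (inversions (p \<circ> s))) \<longleftrightarrow> odd (card (inversions p))"
proof -
  obtain x where x: "inversions (p \<circ> s) = sym_diff (inversions p) {x}"
    using inversions_comp_adjacent[OF assms] .
  show ?thesis
  proof (cases "x \<in> inversions p")
    case True
    then have "inversions (p \<circ> s) = inversions p - {x}" "card (inversions p) \<noteq> 0"
      using x finite_inversions[OF p] by auto
    then show ?thesis
      using True by simp
  next
    case False
    then have "inversions (p \<circ> s) = insert x (inversions p)"
      using x by auto
    then show ?thesis
      using False finite_inversions[OF p] by simp
  qed
qed

text \<open>Left multiplication by \<open>inv' u\<close> is a graph automorphism taking
  \<open>u\<close> to \<open>id\<close> and \<open>v\<close> to \<open>inv' u \<circ> v\<close>, so
  it suffices to bound the intersections of a ball about \<open>id\<close> with one about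
  \<open>y\<close> and to attain the bound once.\<close>

lemma max_ball_inter_bubble_sort_graph:
  assumes upper: "\<And>y. y permutes {1..n} \<Longrightarrow> y \<noteq> id \<Longrightarrow>
      card (short_words n r \<inter> (\<lambda>w. y \<circ> w) ` short_words n r) \<le> k"
    and y: "y permutes {1..n}" "y \<noteq> id"
    and lower: "k \<le> card (short_words n r \<inter> (\<lambda>w. y \<circ> w) ` short_words n r)"
  shows "max_ball_inter (bubble_sort_graph n) r = k"
proof -
  let ?W = "short_words n r"
  have ball: "graph_ball (bubble_sort_graph n) r u = (\<lambda>w. u \<circ> w) ` ?W" if "u permutes {1..n}" for u
    using that by (rule graph_ball_bubble_sort_graph)
  have translate: "card (graph_ball (bubble_sort_graph n) r u \<inter> graph_ball (bubble_sort_graph n) r v)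
      = card (?W \<inter> (\<lambda>w. (inv' u \<circ> v) \<circ> w) ` ?W)"
    if u: "u permutes {1..n}" and v: "v permutes {1..n}" for u v
  proof -
    have cancel: "u \<circ> (inv' u \<circ> g) = g" "inv' u \<circ> (u \<circ> g) = g" for g :: "nat \<Rightarrow> nat"
      using permutes_inv_o[OF u] by (simp_all flip: comp_assoc)
    have inj: "inj (\<lambda>g :: nat \<Rightarrow> nat. u \<circ> g)"
      by (rule injI) (metis cancel(2))
    \<comment> \<open>Multiplying back by \<open>u\<close> carries the normalised intersection
      injectively onto the original one, so the two have the same size.\<close>
    have "(\<lambda>g. u \<circ> g) ` (?W \<inter> (\<lambda>w. (inv' u \<circ> v) \<circ> w) ` ?W)
        = (\<lambda>w. u \<circ> w) ` ?W \<inter> (\<lambda>w. v \<circ> w) ` ?W"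
      unfolding image_Int[OF inj] image_image by (simp add: comp_assoc cancel)
    then show ?thesis
      using card_image[OF inj_on_subset[OF inj subset_UNIV]] by (metis ball u v)
  qed
  let ?S = "{card (graph_ball (bubble_sort_graph n) r u \<inter> graph_ball (bubble_sort_graph n) r v)
      | u v. u \<in> verts (bubble_sort_graph n) \<and> v \<in> verts (bubble_sort_graph n) \<and> u \<noteq> v}"
  let ?P = "{p. p permutes {1..n}}"
  have verts: "verts (bubble_sort_graph n) = ?P"
    by (simp add: pverts_bubble_sort_graph)
  have le: "m \<le> k" if "m \<in> ?S" for m
  proof -
    from that obtain u v where u: "u permutes {1..n}" and v: "v permutes {1..n}" and "u \<noteq> v"
      and m: "m = card (graph_ball (bubble_sort_graph n) r u \<inter> graph_ball (bubble_sort_graph n) r v)"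
      unfolding verts by blast
    have "inv' u \<circ> v \<noteq> id"
    proof
      assume "inv' u \<circ> v = id"
      then have "u \<circ> (inv' u \<circ> v) = u"
        by simp
      then show False
        using \<open>u \<noteq> v\<close> permutes_inv_o(1)[OF u] by (simp flip: comp_assoc)
    qed
    then show ?thesis
      unfolding m translate[OF u v]
      by (intro upper permutes_compose[OF v permutes_inv[OF u]])
  qed
  have "card (graph_ball (bubble_sort_graph n) r id \<inter> graph_ball (bubble_sort_graph n) r y) \<in> ?S"
    unfolding verts using y permutes_id by blast
  moreover have "card (graph_ball (bubble_sort_graph n) r id \<inter> graph_ball (bubble_sort_graph n) r y) = k"
    unfolding translate[OF permutes_id y(1)] using upper[OF y] lower by simp
  ultimately have "k \<in> ?S"
    by simp
  moreover have "finite ?S"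
    by (rule finite_subset[of _ "{..k}"]) (use le in auto)
  ultimately show ?thesis
    unfolding max_ball_inter_def using le by (intro Max_eqI)
qed

text \<open>A common point is a short word applied to \<open>id\<close> and also one applied to
  \<open>y\<close>; each description gives one of the two distance bounds.\<close>

lemma ball_inter_inversions_bounds:
  assumes y: "y permutes {1..n}"
    and A: "A \<in> inversions ` (short_words n r \<inter> (\<lambda>w. y \<circ> w) ` short_words n r)"
  shows "finite A" "card A \<le> r" "card (sym_diff A (inversions y)) \<le> r"
proof -
  from A obtain z where A_eq: "A = inversions z"
    and Z: "z \<in> short_words n r \<inter> (\<lambda>w. y \<circ> w) ` short_words n r"
    by (rule imageE)
  from IntD2[OF Z] obtain w where w: "z = y \<circ> w" "w \<in> short_words n r"
    by (rule imageE)
  note z = A_eq IntD1[OF Z]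
  show "finite A"
    using finite_inversions[OF short_words_permutes[OF z(2)]] z(1) by simp
  show "card A \<le> r"
    using card_sym_diff_le[OF permutes_id z(2)] z(1) by simp
  show "card (sym_diff A (inversions y)) \<le> r"
    using card_sym_diff_le[OF y w(2)] unfolding z(1) w(1) .
qed

lemma card_eq_inversions_image:
  assumes "\<And>z. z \<in> Z \<Longrightarrow> z permutes {1..n}"
  shows "card (inversions ` Z) = card Z"
proof (rule card_image, rule inj_onI)
  fix u v assume "u \<in> Z" "v \<in> Z" "inversions u = inversions v"
  then show "u = v"
    by (intro inversions_inj[OF assms assms])
qed

subsection \<open>Radius one\<close>

text \<open>If \<open>y\<close> has a single inversion \<open>x\<close>, only \<open>{}\<close> and
  \<open>{x}\<close> are within distance one of both \<open>{}\<close> and \<open>{x}\<close>.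
  Otherwise a common neighbour exists only when \<open>y\<close> has two inversions, and its
  inversion set is one of the two singletons inside.\<close>

lemma card_ball_one_inter_le:
  assumes y: "y permutes {1..n}" "y \<noteq> id"
  shows "card (short_words n 1 \<inter> (\<lambda>w. y \<circ> w) ` short_words n 1) \<le> 2"
proof -
  let ?Z = "short_words n 1 \<inter> (\<lambda>w. y \<circ> w) ` short_words n 1"
  let ?D = "inversions y"
  have D: "finite ?D" "?D \<noteq> {}"
    using y finite_inversions inversions_nonempty by auto
  note bounds = ball_inter_inversions_bounds[OF y(1), where r = 1]
  have "\<exists>U V. inversions ` ?Z \<subseteq> {U, V}"
  proof (cases "card ?D = 1")
    case True
    then obtain x where x: "?D = {x}"
      by (auto simp: card_1_singleton_iff)
    have "A \<in> {{}, {x}}" if "A \<in> inversions ` ?Z" for A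
    proof (cases "A = {}")
      case False
      then have "card A = 1"
        using bounds(1)[OF that] bounds(2)[OF that] by (simp add: le_Suc_eq)
      then obtain u where u: "A = {u}"
        by (rule card_1_singletonE)
      then show ?thesis
        using bounds(3)[OF that] x by (cases "u = x") (auto simp: insert_Diff_if)
    qed simp
    then show ?thesis
      by (intro exI subsetI)
  next
    case False
    have sub: "A \<subseteq> ?D \<and> card A = 1 \<and> card ?D = 2" if "A \<in> inversions ` ?Z" for A
    proof -
      \<comment> \<open>Both summands are at most 1 while \<open>card ?D\<close> is at least 2, so
        equality holds throughout and \<open>A - ?D\<close> is empty.\<close>
      have "card ?D \<le> card A + card (?D - A)"
        using diff_card_le_card_Diff[OF bounds(1)[OF that], of ?D] by linarith
      moreover have "card (sym_diff A ?D) = card (A - ?D) + card (?D - A)"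
        using D bounds(1)[OF that] by (intro card_Un_disjoint) auto
      moreover have "card ?D > 1"
        using D False card_gt_0_iff[of ?D] by linarith
      ultimately have "card (A - ?D) = 0 \<and> card A = 1 \<and> card ?D = 2"
        using bounds(2)[OF that] bounds(3)[OF that] by linarith
      then show ?thesis
        using bounds(1)[OF that] by auto
    qed
    show ?thesis
    proof (cases "inversions ` ?Z = {}")
      case False
      then have "card ?D = 2"
        using sub by auto
      then obtain u v where uv: "?D = {u, v}"
        by (auto simp: card_2_iff)
      have "A \<in> {{u}, {v}}" if "A \<in> inversions ` ?Z" for A
        using sub[OF that] uv by (auto simp: card_1_singleton_iff)
      then show ?thesis
        by (intro exI subsetI)
    qed simp
  qed
  then obtain U V where "inversions ` ?Z \<subseteq> {U, V}"
    by blast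
  then have "card (inversions ` ?Z) \<le> card {U, V}"
    by (intro card_mono) auto
  also have "\<dots> \<le> 2"
    by (simp add: card_insert_if)
  finally show ?thesis
    by (subst card_eq_inversions_image[symmetric, of _ n]) (rule short_words_permutes, erule IntD1)
qed

subsection \<open>Radius two\<close>

lemma even_card_inversions_two:
  assumes y: "y permutes {1..n}"
    and "s \<in> adjacent_transpositions n" "t \<in> adjacent_transpositions n"
  shows "even (card (inversions (y \<circ> (s \<circ> t)))) \<longleftrightarrow> even (card (inversions y))"
  using even_card_inversions_comp[OF permutes_compose[OF adjacent_transposition_permutes y], of s t]
    even_card_inversions_comp[OF y, of s] assms by (simp add: comp_assoc)

section \<open>Inversions and number of the adjacent transpositions\<close>

lemma adjacent_transpositions_eq_image:
  "adjacent_transpositions n = (\<lambda>i. transpose i (i + 1)) ` {1..<n}"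
  by (auto simp: adjacent_transpositions_def)

lemma finite_adjacent_transpositions: "finite (adjacent_transpositions n)"
  by (simp add: adjacent_transpositions_eq_image)

lemma inversions_transpose: "inversions (transpose i (i + 1)) = {(i, i + 1)}"
  using inversions_comp_transpose[OF bij_id, of i] by simp

lemma card_adjacent_transpositions: "card (adjacent_transpositions n) = n - 1"
proof -
  have "inj (\<lambda>i :: nat. transpose i (i + 1))"
  proof (rule injI)
    fix i j :: nat assume "transpose i (i + 1) = transpose j (j + 1)"
    then have "{(i, i + 1)} = {(j, j + 1)}"
      by (metis inversions_transpose)
    then show "i = j"
      by simp
  qed
  then show ?thesis
    unfolding adjacent_transpositions_eq_image
    by (subst card_image) (auto intro: inj_on_subset)
qed

text \<open>For a common point \<open>z = y \<circ> w\<close>, either \<open>z\<close> is odd and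
  hence a single letter, or multiplication by \<open>w\<close> changes the parity of
  \<open>y\<close> and \<open>w\<close> is a single letter. Each case allows \<open>n - 1\<close>
  points.\<close>

lemma card_ball_two_inter_odd_le:
  assumes y: "y permutes {1..n}" and odd: "odd (card (inversions y))"
  shows "card (short_words n 2 \<inter> (\<lambda>w. y \<circ> w) ` short_words n 2) \<le> 2 * (n - 1)"
proof -
  let ?S = "adjacent_transpositions n"
  \<comment> \<open>Words of length zero or two preserve parity. This is applied with
    \<open>p = id\<close> to \<open>z\<close> and with \<open>p = y\<close> to
    \<open>w\<close>.\<close>
  have S: "w \<in> ?S" if w: "w \<in> short_words n 2" and p: "p permutes {1..n}"
    and parity: "even (card (inversions (p \<circ> w))) \<longleftrightarrow> odd (card (inversions p))" for p w
  proof (rule ccontr)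
    assume "w \<notin> ?S"
    then consider "w = id" | s t where "s \<in> ?S" "t \<in> ?S" "w = s \<circ> t"
      using w unfolding short_words_two by blast
    then show False
    proof cases
      case 1
      then show False using parity by simp
    next
      case 2
      then show False using parity even_card_inversions_two[OF p, of s t] by simp
    qed
  qed
  have "short_words n 2 \<inter> (\<lambda>w. y \<circ> w) ` short_words n 2 \<subseteq> ?S \<union> (\<lambda>w. y \<circ> w) ` ?S"
  proof
    fix z assume "z \<in> short_words n 2 \<inter> (\<lambda>w. y \<circ> w) ` short_words n 2"
    then obtain w where z: "z \<in> short_words n 2" and w: "w \<in> short_words n 2" "z = y \<circ> w"
      by blast
    show "z \<in> ?S \<union> (\<lambda>w. y \<circ> w) ` ?S"
    proof (cases "odd (card (inversions z))")
      case True
      then show ?thesis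
        using S[OF z permutes_id] by simp
    next
      case False
      then have "w \<in> ?S"
        using S[OF w(1) y] odd w(2) by simp
      then show ?thesis
        using w(2) by blast
    qed
  qed
  then have "card (short_words n 2 \<inter> (\<lambda>w. y \<circ> w) ` short_words n 2)
      \<le> card (?S \<union> (\<lambda>w. y \<circ> w) ` ?S)"
    by (intro card_mono) (simp_all add: finite_adjacent_transpositions)
  also have "\<dots> \<le> card ?S + card ((\<lambda>w. y \<circ> w) ` ?S)"
    by (rule card_Un_le)
  also have "\<dots> \<le> card ?S + card ?S"
    by (intro add_left_mono card_image_le finite_adjacent_transpositions)
  finally show ?thesis
    by (simp add: card_adjacent_transpositions)
qed

section \<open>Products of two adjacent transpositions\<close>

definition two_step :: "nat \<Rightarrow> nat \<Rightarrow> (nat \<times> nat) set" where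
  "two_step a b = {(a, a + 1),
     if b = a + 1 then (a, a + 2) else if a = b + 1 then (b, b + 2) else (b, b + 1)}"

text \<open>The first letter creates \<open>(a, a + 1)\<close>; the second creates the pair of
  values that the first has put at positions \<open>b\<close> and \<open>b + 1\<close>. These differ
  by two exactly when the letters are neighbours.\<close>

lemma inversions_two_step:
  assumes "a \<noteq> b"
  shows "inversions (transpose a (a + 1) \<circ> transpose b (b + 1)) = two_step a b"
proof -
  have "inversions (transpose a (a + 1) \<circ> transpose b (b + 1)) =
      sym_diff {(a, a + 1)} {(min (transpose a (a + 1) b) (transpose a (a + 1) (b + 1)),
        max (transpose a (a + 1) b) (transpose a (a + 1) (b + 1)))}"
    using inversions_comp_transpose[OF bij_transpose, of a "a + 1" b] inversions_transpose[of a] by simp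
  then show ?thesis
    using assms by (auto simp: two_step_def transpose_def)
qed

lemma short_words_two_inversions:
  assumes "w \<in> short_words n 2"
  shows "inversions w = {} \<or> (\<exists>k. inversions w = {(k, k + 1)}) \<or>
    (\<exists>a b. a \<in> {1..<n} \<and> b \<in> {1..<n} \<and> a \<noteq> b \<and> inversions w = two_step a b)"
proof -
  consider "w = id" | "w \<in> adjacent_transpositions n"
    | s t where "s \<in> adjacent_transpositions n" "t \<in> adjacent_transpositions n" "w = s \<circ> t"
    using assms unfolding short_words_two by blast
  then show ?thesis
  proof cases
    case 1
    then show ?thesis by simp
  next
    case 2
    then show ?thesis
      unfolding adjacent_transpositions_eq_image using inversions_transpose by blast
  next
    case 3
    then obtain a b where ab: "a \<in> {1..<n}" "b \<in> {1..<n}"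
        "w = transpose a (a + 1) \<circ> transpose b (b + 1)"
      unfolding adjacent_transpositions_eq_image by blast
    show ?thesis
    proof (cases "a = b")
      case True
      then show ?thesis using ab by simp
    next
      case False
      then show ?thesis using ab inversions_two_step by blast
    qed
  qed
qed

text \<open>Removing the two inversions one at a time reaches the identity, so \<open>y\<close> is a
  product of two letters; having two inversions, it is neither the identity nor a single
  letter.\<close>

lemma two_inversions:
  assumes y: "y permutes {1..n}" and card: "card (inversions y) = 2"
  obtains i j where "i \<in> {1..<n}" "j \<in> {1..<n}" "i \<noteq> j" "inversions y = two_step i j"
proof -
  obtain s q where q: "s \<in> adjacent_transpositions n" "q permutes {1..n}" "y = q \<circ> s"
      "card (inversions q) = 1"
    using remove_inversion[OF y, of 1] card by auto
  obtain t q' where q': "t \<in> adjacent_transpositions n" "q' permutes {1..n}" "q = q' \<circ> t"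
      "card (inversions q') = 0"
    using remove_inversion[OF q(2), of 0] q(4) by auto
  have "q' = id"
    using inversions_nonempty[OF q'(2)] finite_inversions[OF q'(2)] q'(4) by auto
  then have "y = t \<circ> s"
    using q q' by simp
  then have "y \<in> short_words n 2"
    unfolding short_words_two using q(1) q'(1) by blast
  then have "\<exists>a b. a \<in> {1..<n} \<and> b \<in> {1..<n} \<and> a \<noteq> b \<and> inversions y = two_step a b"
    using short_words_two_inversions[of y n] card by auto
  then show thesis
    using that by blast
qed

section \<open>Inversion sets sharing a pair with a two-letter product\<close>

lemma two_step_commute:
  "b \<noteq> a + 1 \<Longrightarrow> a \<noteq> b + 1 \<Longrightarrow> two_step a b = two_step b a"
  by (simp add: two_step_def insert_commute)

lemma mem_two_step_iff:
  "(k, k + 1) \<in> two_step a b \<longleftrightarrow> k = a \<or> k = b \<and> b \<noteq> a + 1 \<and> a \<noteq> b + 1"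
  "(k, k + 2) \<in> two_step a b \<longleftrightarrow> a = k \<and> b = k + 1 \<or> a = k + 1 \<and> b = k"
proof -
  consider "b = a + 1" | "a = b + 1" | "b \<noteq> a + 1" "a \<noteq> b + 1"
    by blast
  then have "((k, k + 1) \<in> two_step a b \<longleftrightarrow> k = a \<or> k = b \<and> b \<noteq> a + 1 \<and> a \<noteq> b + 1) \<and>
      ((k, k + 2) \<in> two_step a b \<longleftrightarrow> a = k \<and> b = k + 1 \<or> a = k + 1 \<and> b = k)"
    by cases (auto simp: two_step_def)
  then show "(k, k + 1) \<in> two_step a b \<longleftrightarrow> k = a \<or> k = b \<and> b \<noteq> a + 1 \<and> a \<noteq> b + 1"
    "(k, k + 2) \<in> two_step a b \<longleftrightarrow> a = k \<and> b = k + 1 \<or> a = k + 1 \<and> b = k"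
    by blast+
qed

text \<open>If \<open>k\<close> is not the first letter, then it is the second one and the two
  letters commute, so \<open>k\<close> can be moved to the front.\<close>

lemma simple_mem_two_step:
  assumes "(k, k + 1) \<in> two_step a b" "a \<in> X" "b \<in> X" "a \<noteq> b"
  obtains c where "two_step a b = two_step k c" "c \<in> X" "c \<noteq> k"
proof (cases "a = k")
  case False
  then have b: "b = k" "b \<noteq> a + 1" "a \<noteq> b + 1"
    using assms(1) unfolding mem_two_step_iff by blast+
  then show thesis
    using that[of a] two_step_commute[of b a] assms False by metis
qed (use that assms in metis)

lemma card_two_step_image_le:
  assumes "i \<in> {1..<n}" "j \<in> {1..<n}" "i \<noteq> j"
  shows "card (two_step k ` ({1..<n} - {i, j})) \<le> n - 3"
proof -
  have "card ({1..<n} - {i, j}) = n - 3"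
    using assms by (subst card_Diff_subset) auto
  then show ?thesis
    using card_image_le[of "{1..<n} - {i, j}" "two_step k"] by simp
qed

text \<open>A member other than a few explicit sets must contain a pair \<open>(k, k + 1)\<close> of
  \<open>two_step i j\<close>, so it is \<open>two_step k c\<close> with \<open>c\<close> outside
  \<open>{i, j}\<close>. Each admissible \<open>k\<close> contributes at most \<open>n - 3\<close>
  such sets.\<close>

lemma card_two_step_neighbours_le:
  assumes ij: "i \<in> {1..<n}" "j \<in> {1..<n}" "i \<noteq> j"
    and form: "\<And>A. A \<in> T \<Longrightarrow> A = {} \<or> (\<exists>k. A = {(k, k + 1)}) \<or>
      (\<exists>a b. a \<in> {1..<n} \<and> b \<in> {1..<n} \<and> a \<noteq> b \<and> A = two_step a b)"
    and meet: "\<And>A. A \<in> T \<Longrightarrow> A \<noteq> {} \<Longrightarrow> A \<inter> two_step i j \<noteq> {}"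
  shows "card T \<le> 2 * (n - 1)"
proof -
  define R where "R k = two_step k ` ({1..<n} - {i, j})" for k
  have R: "finite (R k)" "card (R k) \<le> n - 3" for k
    using card_two_step_image_le[OF ij] by (simp_all add: R_def)
  show ?thesis
  proof (cases "i = j + 1 \<or> j = i + 1")
    case True
    define m where "m = min i j"
    have m: "two_step i j = {(i, i + 1), (m, m + 2)}" "{i, j} = {m, m + 1}"
      using True by (auto simp: two_step_def m_def)
    \<comment> \<open>For neighbouring letters the only pair of the form \<open>(k, k + 1)\<close>
      in \<open>two_step i j\<close> is that of \<open>i\<close>, so the family \<open>R j\<close>
      does not occur.\<close>
    have "A \<in> {{}, {(i, i + 1)}, two_step i j, two_step j i} \<union> R i" if "A \<in> T" for A
    proof (rule ccontr)
      assume neg: "\<not> ?thesis"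
      with form[OF that] meet[OF that] consider k where "A = {(k, k + 1)}"
        | a b where "a \<in> {1..<n}" "b \<in> {1..<n}" "a \<noteq> b" "A = two_step a b"
        by blast
      then show False
      proof cases
        case 1
        then show False
          using meet[OF that] neg unfolding m by auto
      next
        case 2
        \<comment> \<open>A pair with difference two arises only from the letters \<open>m\<close>
          and \<open>m + 1\<close> in some order, which gives one of the listed sets.\<close>
        have "(m, m + 2) \<notin> A"
        proof
          assume "(m, m + 2) \<in> A"
          then have "a = m \<and> b = m + 1 \<or> a = m + 1 \<and> b = m"
            using 2 mem_two_step_iff(2) by metis
          then have "a = i \<and> b = j \<or> a = j \<and> b = i"
            using True by (auto simp: m_def)
          then show False
            using 2 neg by blast
        qed
        moreover have "A \<inter> two_step i j \<noteq> {}"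
          using meet[OF that] neg by blast
        ultimately have "(i, i + 1) \<in> A"
          unfolding m by blast
        then have "\<exists>c \<in> {1..<n}. A = two_step i c \<and> c \<noteq> i"
          using simple_mem_two_step[of i a b "{1..<n}"] 2 by metis
        then show False
          using neg unfolding R_def by blast
      qed
    qed
    then have "card T \<le> card ({{}, {(i, i + 1)}, two_step i j, two_step j i} \<union> R i)"
      using R by (intro card_mono) auto
    also have "\<dots> \<le> card {{}, {(i, i + 1)}, two_step i j, two_step j i} + card (R i)"
      by (rule card_Un_le)
    also have "\<dots> \<le> 4 + (n - 3)"
      by (intro add_mono R(2)) (simp add: card_insert_if)
    \<comment> \<open>Two distinct letters force \<open>n \<ge> 3\<close>, whence
      \<open>n + 1 \<le> 2 * (n - 1)\<close>.\<close>
    also have "\<dots> \<le> 2 * (n - 1)"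
      using ij True by auto
    finally show ?thesis .
  next
    case False
    then have D: "two_step i j = {(i, i + 1), (j, j + 1)}" "two_step j i = two_step i j"
      using ij by (auto simp: two_step_def)
    \<comment> \<open>For commuting letters either pair may be the shared one, so both families
      occur; the total \<open>4 + 2 * (n - 3)\<close> is exactly \<open>2 * (n - 1)\<close>.\<close>
    have "A \<in> {{}, {(i, i + 1)}, {(j, j + 1)}, two_step i j} \<union> (R i \<union> R j)" if "A \<in> T" for A
    proof (rule ccontr)
      assume neg: "\<not> ?thesis"
      with form[OF that] meet[OF that] consider k where "A = {(k, k + 1)}"
        | a b where "a \<in> {1..<n}" "b \<in> {1..<n}" "a \<noteq> b" "A = two_step a b"
        by blast
      then show False
      proof cases
        case 1
        then show False
          using meet[OF that] neg unfolding D by auto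
      next
        case 2
        have "A \<inter> two_step i j \<noteq> {}"
          using meet[OF that] neg by blast
        then obtain k where k: "k = i \<or> k = j" "(k, k + 1) \<in> A"
          unfolding D by blast
        then have "\<exists>c \<in> {1..<n}. A = two_step k c \<and> c \<noteq> k"
          using simple_mem_two_step[of k a b "{1..<n}"] 2 by metis
        then show False
          using neg k(1) D(2) unfolding R_def by blast
      qed
    qed
    then have "card T \<le> card ({{}, {(i, i + 1)}, {(j, j + 1)}, two_step i j} \<union> (R i \<union> R j))"
      using R by (intro card_mono) auto
    also have "\<dots> \<le> card {{}, {(i, i + 1)}, {(j, j + 1)}, two_step i j} + (card (R i) + card (R j))"
      by (intro order.trans[OF card_Un_le] add_left_mono card_Un_le)
    also have "\<dots> \<le> 4 + ((n - 3) + (n - 3))"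
      by (intro add_mono R(2)) (simp add: card_insert_if)
    also have "\<dots> \<le> 2 * (n - 1)"
      using ij False by auto
    finally show ?thesis .
  qed
qed

text \<open>A common point forces at most four inversions of \<open>y\<close>, so parity leaves two
  or four. All counting is done on the inversion sets of the common points.\<close>

lemma card_ball_two_inter_even_le:
  assumes n: "n \<ge> 3" and y: "y permutes {1..n}" "y \<noteq> id"
    and even: "even (card (inversions y))"
  shows "card (short_words n 2 \<inter> (\<lambda>w. y \<circ> w) ` short_words n 2) \<le> 2 * (n - 1)"
proof -
  let ?T = "inversions ` (short_words n 2 \<inter> (\<lambda>w. y \<circ> w) ` short_words n 2)"
  let ?D = "inversions y"
  have D: "finite ?D" "card ?D \<noteq> 0"
    using y finite_inversions[OF y(1)] inversions_nonempty[OF y] by auto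
  note bounds = ball_inter_inversions_bounds[OF y(1), where r = 2]
  have card_D: "card ?D = card (A \<inter> ?D) + card (?D - A)" for A
    using card_Diff_subset_Int[of ?D A] card_mono[of ?D "?D \<inter> A"] D by (simp add: Int_commute)
  have split: "card A = card (A \<inter> ?D) + card (A - ?D)"
    "card (sym_diff A ?D) = card (A - ?D) + card (?D - A)" if "A \<in> ?T" for A
  proof -
    show "card A = card (A \<inter> ?D) + card (A - ?D)"
      using bounds(1)[OF that] card_Diff_subset_Int[of A ?D] card_mono[of A "A \<inter> ?D"] by simp
    show "card (sym_diff A ?D) = card (A - ?D) + card (?D - A)"
      using bounds(1)[OF that] D by (intro card_Un_disjoint) auto
  qed
  have "card ?T \<le> 2 * (n - 1)"
  proof (cases "card ?D = 2")
    case True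
    obtain i j where ij: "i \<in> {1..<n}" "j \<in> {1..<n}" "i \<noteq> j" and D_eq: "?D = two_step i j"
      using two_inversions[OF y(1) True] .
    show ?thesis
    proof (rule card_two_step_neighbours_le[OF ij])
      fix A assume A: "A \<in> ?T"
      then show "A = {} \<or> (\<exists>k. A = {(k, k + 1)}) \<or>
          (\<exists>a b. a \<in> {1..<n} \<and> b \<in> {1..<n} \<and> a \<noteq> b \<and> A = two_step a b)"
        using short_words_two_inversions by (elim imageE IntE) (simp only:)
      assume "A \<noteq> {}"
      then have "card A \<noteq> 0"
        using bounds(1)[OF A] by simp
      \<comment> \<open>If \<open>A\<close> were disjoint from \<open>?D\<close>, their symmetric
        difference would have \<open>card A + 2 > 2\<close> elements.\<close>
      then have "card (A \<inter> ?D) \<noteq> 0"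
        using split[OF A] card_D[of A] bounds(3)[OF A] True by linarith
      then show "A \<inter> two_step i j \<noteq> {}"
        unfolding D_eq by auto
    qed
  next
    case False
    show ?thesis
    proof (cases "?T = {}")
      case nonempty: False
      \<comment> \<open>\<open>card ?D\<close> is at most \<open>card A\<close> plus the size of the
        symmetric difference, hence at most 4; equality makes \<open>A\<close> a two-element subset
        of \<open>?D\<close>.\<close>
      have four: "card ?D = 4 \<and> card A = 2 \<and> card (A - ?D) = 0" if "A \<in> ?T" for A
      proof -
        have "card ?D \<noteq> 1" "card ?D \<noteq> 3"
          using even by auto
        then have "card ?D \<ge> 4"
          using False D(2) by linarith
        then show ?thesis
          using split[OF that] card_D[of A] bounds(2)[OF that] bounds(3)[OF that] by linarith
      qed
      then have "?T \<subseteq> {A. A \<subseteq> ?D \<and> card A = 2}"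
        using bounds(1) by fastforce
      moreover have card_4: "card ?D = 4"
        using four nonempty by blast
      ultimately have "card ?T \<le> card {A. A \<subseteq> ?D \<and> card A = 2}"
        using D by (intro card_mono) auto
      also have "\<dots> = 6"
        by (simp add: n_subsets[OF D(1)] card_4 choose_two)
      also have "6 \<le> 2 * (n - 1)"
      proof -
        \<comment> \<open>The bound 6 needs \<open>n \<ge> 4\<close>; for \<open>n = 3\<close> there
          are only three pairs, too few for four inversions.\<close>
        have "n \<noteq> 3"
        proof
          assume "n = 3"
          then have "?D \<subseteq> {(1, 2), (1, 3), (2, 3)}"
            using inversions_subset[OF y(1)] by fastforce
          then have "card ?D \<le> 3"
            using card_mono[of "{(1, 2), (1, 3), (2, 3)} :: (nat \<times> nat) set" ?D] by simp
          then show False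
            using card_4 by simp
        qed
        then show ?thesis
          using n by simp
      qed
      finally show ?thesis .
    qed simp
  qed
  moreover have "card ?T = card (short_words n 2 \<inter> (\<lambda>w. y \<circ> w) ` short_words n 2)"
    by (rule card_eq_inversions_image[of _ n]) (rule short_words_permutes, erule IntD1)
  ultimately show ?thesis
    by simp
qed

text \<open>All neighbours of \<open>id\<close> and all neighbours of \<open>y\<close> lie in both
  balls, because \<open>id\<close> and \<open>y\<close> are adjacent. The two families have
  \<open>n - 1\<close> members each and opposite parity, so they are disjoint.\<close>

lemma card_ball_two_inter_adjacent_ge:
  assumes y: "y \<in> adjacent_transpositions n"
  shows "2 * (n - 1) \<le> card (short_words n 2 \<inter> (\<lambda>w. y \<circ> w) ` short_words n 2)"
proof -
  let ?S = "adjacent_transpositions n"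
  let ?yS = "(\<lambda>w. y \<circ> w) ` ?S"
  have cancel: "y \<circ> (y \<circ> w) = w" for w :: "nat \<Rightarrow> nat"
    using adjacent_transposition_involutory[OF y] by (simp flip: comp_assoc)
  have "inj (\<lambda>w :: nat \<Rightarrow> nat. y \<circ> w)"
    by (rule injI) (metis cancel)
  then have "card ?yS = n - 1"
    by (simp add: card_image inj_on_subset card_adjacent_transpositions)
  moreover have "?S \<inter> ?yS = {}"
  proof -
    have "odd (card (inversions s))" if "s \<in> ?S" for s
      using that by (auto simp: adjacent_transpositions_def inversions_transpose[simplified])
    moreover have "even (card (inversions (y \<circ> s)))" if "s \<in> ?S" for s
      using even_card_inversions_two[OF permutes_id y that] by simp
    ultimately show ?thesis
      by fastforce
  qed
  ultimately have card: "card (?S \<union> ?yS) = 2 * (n - 1)"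
    by (simp add: card_Un_disjoint finite_adjacent_transpositions card_adjacent_transpositions)
  have "?S \<union> ?yS \<subseteq> short_words n 2"
    unfolding short_words_two using y by blast
  \<comment> \<open>Since \<open>y\<close> is an involution,
    \<open>w = y \<circ> (y \<circ> w)\<close>, so membership in the ball about \<open>y\<close>
    reduces to \<open>y \<circ> w\<close> being short.\<close>
  moreover have "w \<in> (\<lambda>w. y \<circ> w) ` short_words n 2" if "y \<circ> w \<in> short_words n 2" for w
    using that by (metis cancel image_eqI)
  then have "?S \<union> ?yS \<subseteq> (\<lambda>w. y \<circ> w) ` short_words n 2"
    unfolding short_words_two using y by blast
  ultimately show ?thesis
    unfolding card[symmetric] by (intro card_mono finite_Int disjI1 finite_short_words) blast
qed

theorem theorem6:
  fixes n :: nat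
  assumes "n \<ge> 3"
  shows "max_ball_inter (bubble_sort_graph n) 1 = 2 \<and>
         max_ball_inter (bubble_sort_graph n) 2 = 2 * (n - 1)"
proof
  \<comment> \<open>The adjacent vertices \<open>id\<close> and \<open>y\<close> attain the maximum
    for both radii.\<close>
  define y :: "nat \<Rightarrow> nat" where "y = transpose 1 2"
  have y_adj: "y \<in> adjacent_transpositions n"
    using assms unfolding y_def adjacent_transpositions_def by (intro CollectI exI[of _ 1]) (simp add: numeral_2_eq_2)
  have y: "y permutes {1..n}"
    using y_adj by (rule adjacent_transposition_permutes)
  have "y 1 \<noteq> id 1"
    by (simp add: y_def)
  then have ne: "y \<noteq> id"
    by metis
  have "y \<circ> y = id"
    using y_adj by (rule adjacent_transposition_involutory)
  then have "{id, y} \<subseteq> short_words n 1 \<inter> (\<lambda>w. y \<circ> w) ` short_words n 1"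
    using y_adj unfolding short_words_one by (simp add: image_iff) metis
  then have "card {id, y} \<le> card (short_words n 1 \<inter> (\<lambda>w. y \<circ> w) ` short_words n 1)"
    by (intro card_mono finite_Int disjI1 finite_short_words)
  then have lower: "2 \<le> card (short_words n 1 \<inter> (\<lambda>w. y \<circ> w) ` short_words n 1)"
    using ne by simp
  show "max_ball_inter (bubble_sort_graph n) 1 = 2"
    by (rule max_ball_inter_bubble_sort_graph[OF _ y ne lower]) (rule card_ball_one_inter_le)
  show "max_ball_inter (bubble_sort_graph n) 2 = 2 * (n - 1)"
  proof (rule max_ball_inter_bubble_sort_graph[OF _ y ne card_ball_two_inter_adjacent_ge[OF y_adj]])
    fix v assume "v permutes {1..n}" "v \<noteq> id"
    then show "card (short_words n 2 \<inter> (\<lambda>w. v \<circ> w) ` short_words n 2) \<le> 2 * (n - 1)"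
      using card_ball_two_inter_even_le[OF assms] card_ball_two_inter_odd_le by blast
  qed
qed

end
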